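(* Let $\mathbf{H}$ be one of $\mathbf{Z}$, $\mathbf{N}$, $\mathbf{N}^+$. Fix $\alpha\in[-1,\infty[$ and $a,b\in\mathbf{R}$ such that $\sum_{i\in F_n}|i|^\alpha\to\infty$ as $n\to\infty$, where $F_n:=[an,bn]\cap\mathbf{H}$ for all $n\in\mathbf{N}^+$, and set $\mathfrak{F}:=(F_n)_{n\ge1}$. Then the function $$\mathsf{d}^\star(\mathfrak{F};\alpha):\mathcal{P}(\mathbf{H})\to\mathbf{R}:\ X\mapsto\limsup_{n\to\infty}\frac{\sum_{i\in X\cap F_n}|i|^\alpha}{\sum_{i\in F_n}|i|^\alpha}$$ (with the convention $\frac00:=1$) is an upper density on $\mathbf{H}$.
   Context: $\mathbf{N}$ is the set of non-negative integers, $\mathbf{N}^+$ the set of positive integers, $\mathcal{P}(\mathbf{H})$ the power set of $\mathbf{H}$. When $\alpha<0$, the index $i=0$ is omitted from all sums of $|i|^\alpha$. An upper density on $\mathbf{H}$ is a function $\mu^\star:\mathcal{P}(\mathbf{H})\to\mathbf{R}$ such that: (F1) $\mu^\star(\mathbf{H})=1$; (F2) $\mu^\star(X)\le\mu^\star(Y)$ whenever $X\subseteq Y\subseteq\mathbf{H}$; (F3) $\mu^\star(X\cup Y)\le\mu^\star(X)+\mu^\star(Y)$ for all $X,Y\subseteq\mathbf{H}$; (F4) $\mu^\star(k\cdot X)=\frac1k\mu^\star(X)$ for all $X\subseteq\mathbf{H}$, $k\in\mathbf{N}^+$, where $k\cdot X:=\{kx:x\in X\}$; (F5) $\mu^\star(X+h)=\mu^\star(X)$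 for all $X\subseteq\mathbf{H}$, $h\in\mathbf{N}$, where $X+h:=\{x+h:x\in X\}$.
   Formalization: The formal statement adds a < b: for a = b the claim is false (e.g. H = Z, a = b = 1, α = 1 gives upper density 1 to both Z and 2Z, violating F4), and for a > b the sums cannot diverge. *)

theory Defs
  imports Complex_Main "HOL-Library.Extended_Real"
begin

definition is_upper_density :: "int set \<Rightarrow> (int set \<Rightarrow> real) \<Rightarrow> bool" where
  "is_upper_density H \<mu> \<longleftrightarrow>
     \<mu> H = 1 \<and>
     (\<forall>X Y. X \<subseteq> Y \<longrightarrow> Y \<subseteq> H \<longrightarrow> \<mu> X \<le> \<mu> Y) \<and>
     (\<forall>X Y. X \<subseteq> H \<longrightarrow> Y \<subseteq> H \<longrightarrow> \<mu> (X \<union> Y) \<le> \<mu> X + \<mu> Y) \<and>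
     (\<forall>X (k::nat). X \<subseteq> H \<longrightarrow> k \<ge> 1 \<longrightarrow> \<mu> ((\<lambda>x. int k * x) ` X) = 1 / real k * \<mu> X) \<and>
     (\<forall>X (h::nat). X \<subseteq> H \<longrightarrow> \<mu> ((\<lambda>x. x + int h) ` X) = \<mu> X)"

definition window :: "int set \<Rightarrow> real \<Rightarrow> real \<Rightarrow> nat \<Rightarrow> int set" where
  "window H a b n = {i \<in> H. a * real n \<le> real_of_int i \<and> real_of_int i \<le> b * real n}"

text \<open>The library has \<open>0 powr 0 = 0\<close>, whereas the usual \<open>0\<^sup>0 = 1\<close> is intended here: for exponent
  \<open>0\<close> the sums below count elements, including \<open>0\<close>.\<close>

definition abs_pow :: "int \<Rightarrow> real \<Rightarrow> real" where
  "abs_pow i \<alpha> = (if i = 0 \<and> \<alpha> = 0 then 1 else \<bar>real_of_int i\<bar> powr \<alpha>)"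

definition pow_sum :: "real \<Rightarrow> int set \<Rightarrow> real" where
  "pow_sum \<alpha> S = (\<Sum>i\<in>(if \<alpha> < 0 then S - {0} else S). abs_pow i \<alpha>)"

definition ratio :: "real \<Rightarrow> real \<Rightarrow> real" where
  "ratio x y = (if x = 0 \<and> y = 0 then 1 else x / y)"

text \<open>The limit superior is taken in the extended reals, where \<open>limsup\<close> always exists.\<close>

definition weighted_limsup :: "int set \<Rightarrow> real \<Rightarrow> real \<Rightarrow> real \<Rightarrow> int set \<Rightarrow> ereal" where
  "weighted_limsup H a b \<alpha> X =
     limsup (\<lambda>n. ereal (ratio (pow_sum \<alpha> (X \<inter> window H a b n)) (pow_sum \<alpha> (window H a b n))))"

end

theory Submission
  imports Defs "HOL-Analysis.Extended_Real_Limits"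
begin

text \<open>
  Write \<open>w i\<close> for the weight \<open>\<bar>i\<bar>\<^sup>\<alpha>\<close>, \<open>S n\<close> for the total weight of the window \<open>F\<^sub>n\<close>, and
  \<open>M X n\<close> for the weight of \<open>X \<inter> F\<^sub>n\<close>. Normalisation, monotonicity and subadditivity hold for the
  quotients \<open>M X n / S n\<close> at every \<open>n\<close> and pass to the limit superior. What needs an argument is the
  behaviour under dilations and translations, and both are covered by one statement about affine
  maps \<open>x \<mapsto> k x + h\<close>:
  the upper density of \<open>k \<cdot> X + h\<close> is \<open>1/k\<close> times that of \<open>X\<close>.

  The heart is the estimate (lemma \<open>mass_affine_image\<close>)
  \<open>M (k \<cdot> X + h) n = k\<^sup>\<alpha> M X m + o(S m)\<close> with \<open>m = n div k\<close>.
  It has two sources of error. First, \<open>w (k j + h)\<close> is only asymptotically equal to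
  \<open>k\<^sup>\<alpha> w j\<close>; since the relative error tends to \<open>0\<close> as \<open>\<bar>j\<bar> \<rightarrow> \<infinity>\<close>, it contributes at most
  \<open>\<epsilon> S m + O(1)\<close> for every \<open>\<epsilon> > 0\<close>, and \<open>S m \<rightarrow> \<infinity>\<close>. Second, the condition
  \<open>k j + h \<in> F\<^sub>n\<close> differs from \<open>j \<in> F\<^sub>m\<close> for boundedly many \<open>j\<close>, all near the end points of
  \<open>F\<^sub>m\<close>, and a single weight there is \<open>o(S m)\<close> (lemma \<open>boundary_weight_negligible\<close>).

  The same estimate controls the growth of \<open>S\<close>: up to finitely many elements, \<open>H\<close> is the disjoint
  union of the progressions \<open>k \<cdot> H + r\<close> with \<open>r < k\<close>, so the estimate for \<open>X = H\<close>, summed over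
  \<open>r\<close>, yields \<open>S n / S (n div k) \<rightarrow> k\<^sup>\<alpha>\<^sup>+\<^sup>1\<close> (lemma \<open>mass_H_growth\<close>). This treats the logarithmic
  case \<open>\<alpha> = -1\<close> on the same footing as the others. Dividing the two relations gives
  \<open>M (k \<cdot> X + h) n / S n - (1/k) M X m / S m \<rightarrow> 0\<close>, and since \<open>n div k\<close> takes every value and tends
  to infinity, the limit superior along \<open>m = n div k\<close> is the limit superior along \<open>n\<close>.
\<close>

section \<open>Limits superior\<close>

lemma limsup_eq_of_diff_tendsto_0:
  fixes f g :: "nat \<Rightarrow> real"
  assumes "(\<lambda>n. f n - g n) \<longlonglongrightarrow> 0"
  shows "limsup (\<lambda>n. ereal (f n)) = limsup (\<lambda>n. ereal (g n))"
proof -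
  have "(\<lambda>n. ereal (f n - g n)) \<longlonglongrightarrow> 0"
    using assms by (simp add: zero_ereal_def)
  then have "limsup (\<lambda>n. ereal (f n - g n) + ereal (g n)) = 0 + limsup (\<lambda>n. ereal (g n))"
    by (intro ereal_limsup_lim_add) auto
  then show ?thesis by simp
qed

text \<open>The map \<open>n \<mapsto> n div k\<close> is onto and tends to infinity, so it carries the filter of
  neighbourhoods of infinity onto itself.\<close>

lemma limsup_div_const:
  fixes g :: "nat \<Rightarrow> 'a :: complete_linorder"
  assumes "k \<ge> 1"
  shows "limsup (\<lambda>n. g (n div k)) = limsup g"
proof -
  have "filtermap (\<lambda>n. n div k) sequentially = sequentially"
  proof (rule filter_eqI)
    fix P :: "nat \<Rightarrow> bool"
    have "(\<exists>N. \<forall>n\<ge>N. P n)" if "\<forall>n\<ge>N. P (n div k)" for N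
    proof (intro exI allI impI)
      fix n assume "N \<le> n"
      also have "n \<le> n * k" using assms by simp
      finally show "P n" using that[rule_format, of "n * k"] assms by simp
    qed
    moreover have "filterlim (\<lambda>n. n div k) sequentially sequentially"
      using assms by (intro filterlim_at_top_div_const_nat) auto
    then have "eventually P sequentially \<longrightarrow> eventually (\<lambda>n. P (n div k)) sequentially"
      unfolding filterlim_iff by blast
    ultimately show "eventually P (filtermap (\<lambda>n. n div k) sequentially) = eventually P sequentially"
      unfolding eventually_filtermap unfolding eventually_sequentially by blast
  qed
  then have "limsup (\<lambda>n. g (n div k)) \<le> limsup g"
    using Limsup_filtermap_ge[of sequentially g "\<lambda>n. n div k"] by simp
  moreover have "limsup ((\<lambda>n. g (n div k)) \<circ> (\<lambda>n. n * k)) \<le> limsup (\<lambda>n. g (n div k))"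
    using assms by (intro limsup_subseq_mono) (auto simp: strict_mono_def)
  ultimately show ?thesis using assms by (simp add: o_def)
qed

section \<open>Weights and windows\<close>

lemma abs_pow_nonneg [simp]: "0 \<le> abs_pow i \<alpha>"
  by (simp add: abs_pow_def)

text \<open>Dropping \<open>0\<close> for negative exponents changes nothing, because \<open>0 powr \<alpha> = 0\<close>.\<close>

lemma pow_sum_eq_sum: "finite S \<Longrightarrow> pow_sum \<alpha> S = (\<Sum>i\<in>S. abs_pow i \<alpha>)"
  by (auto simp: pow_sum_def abs_pow_def intro!: sum.mono_neutral_left)

text \<open>One bound that serves both signs of \<open>\<alpha>\<close>: the weights are at most \<open>1\<close> for \<open>\<alpha> \<le> 0\<close> and
  increase with \<open>\<bar>i\<bar>\<close> for \<open>\<alpha> > 0\<close>.\<close>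

lemma abs_pow_le:
  assumes "\<bar>real_of_int i\<bar> \<le> T" "1 \<le> T"
  shows "abs_pow i \<alpha> \<le> 1 + T powr \<alpha>"
proof (cases "\<alpha> \<le> 0 \<or> i = 0")
  case True
  have "abs_pow i \<alpha> \<le> 1"
  proof (cases "i = 0")
    case False
    then have "1 \<le> \<bar>real_of_int i\<bar>" by linarith
    then have "\<bar>real_of_int i\<bar> powr \<alpha> \<le> \<bar>real_of_int i\<bar> powr 0"
      using True False by (intro powr_mono) auto
    then show ?thesis using False by (simp add: abs_pow_def)
  qed (simp add: abs_pow_def)
  then show ?thesis using powr_ge_zero[of T \<alpha>] by linarith
next
  case False
  then have "abs_pow i \<alpha> \<le> T powr \<alpha>"
    using assms by (auto simp: abs_pow_def intro!: powr_mono2)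
  then show ?thesis by simp
qed

text \<open>The relative error of \<open>\<bar>k j + h\<bar>\<^sup>\<alpha> \<approx> k\<^sup>\<alpha> \<bar>j\<bar>\<^sup>\<alpha>\<close> is governed by \<open>\<bar>k + h/j\<bar>\<^sup>\<alpha> - k\<^sup>\<alpha>\<close>, which
  vanishes as \<open>\<bar>j\<bar> \<rightarrow> \<infinity>\<close> by continuity at \<open>k > 0\<close>.\<close>

lemma abs_pow_affine_asymp:
  assumes "k \<ge> 1" "\<epsilon> > 0"
  obtains R :: nat where
    "\<And>j. int R \<le> \<bar>j\<bar> \<Longrightarrow>
       \<bar>abs_pow (int k * j + int h) \<alpha> - real k powr \<alpha> * abs_pow j \<alpha>\<bar> \<le> \<epsilon> * abs_pow j \<alpha>"
proof -
  have "isCont (\<lambda>x. \<bar>real k + x\<bar> powr \<alpha>) 0"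
    using assms by (intro continuous_intros) auto
  then obtain \<delta> where \<delta>: "\<delta> > 0"
    "\<And>x. \<bar>x\<bar> < \<delta> \<Longrightarrow> \<bar>\<bar>real k + x\<bar> powr \<alpha> - real k powr \<alpha>\<bar> < \<epsilon>"
    using assms unfolding continuous_at_eps_delta by (auto simp: dist_real_def)
  obtain R0 where R0: "real R0 > real h / \<delta>" using reals_Archimedean2 by blast
  \<comment> \<open>The summand \<open>h + 1\<close> keeps both \<open>j\<close> and \<open>k j + h\<close> away from \<open>0\<close>, where the weight is not
    given by \<open>powr\<close> alone.\<close>
  define R where "R = R0 + h + 1"
  have "\<bar>abs_pow (int k * j + int h) \<alpha> - real k powr \<alpha> * abs_pow j \<alpha>\<bar> \<le> \<epsilon> * abs_pow j \<alpha>"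
    if j: "int R \<le> \<bar>j\<bar>" for j
  proof -
    let ?j = "real_of_int j"
    have j0: "j \<noteq> 0" using j by (auto simp: R_def)
    have "int h < \<bar>j\<bar>" using j by (simp add: R_def)
    also have "\<bar>j\<bar> \<le> int k * \<bar>j\<bar>" using assms by (simp add: mult_le_cancel_right1)
    finally have "int h < \<bar>int k * j\<bar>" by (simp add: abs_mult)
    then have nz: "int k * j + int h \<noteq> 0" by auto
    have "real R0 \<le> \<bar>?j\<bar>" using j by (simp add: R_def)
    then have "real h / \<delta> < \<bar>?j\<bar>" using R0 by linarith
    then have "\<bar>real h / ?j\<bar> < \<delta>"
      using \<delta>(1) j0 by (simp add: field_simps)
    note close = \<delta>(2)[OF this]
    have "\<bar>real_of_int (int k * j + int h)\<bar> = \<bar>real k + real h / ?j\<bar> * \<bar>?j\<bar>"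
      using j0 by (simp add: abs_mult[symmetric] field_simps)
    then have "abs_pow (int k * j + int h) \<alpha> = \<bar>real k + real h / ?j\<bar> powr \<alpha> * abs_pow j \<alpha>"
      using nz j0 by (simp add: abs_pow_def powr_mult del: of_int_add of_int_mult)
    then have "\<bar>abs_pow (int k * j + int h) \<alpha> - real k powr \<alpha> * abs_pow j \<alpha>\<bar>
        = \<bar>\<bar>real k + real h / ?j\<bar> powr \<alpha> - real k powr \<alpha>\<bar> * abs_pow j \<alpha>"
      by (simp add: abs_mult left_diff_distrib[symmetric])
    also have "\<dots> \<le> \<epsilon> * abs_pow j \<alpha>"
      using close by (intro mult_right_mono) auto
    finally show ?thesis .
  qed
  then show ?thesis using that by blast
qed

lemma ints_between_eq: "{i::int. x \<le> real_of_int i \<and> real_of_int i \<le> y} = {\<lceil>x\<rceil>..\<lfloor>y\<rfloor>}"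
  by (auto simp: ceiling_le_iff le_floor_iff)

lemma card_ints_between_ge: "y - x - 1 \<le> real (card {i::int. x \<le> real_of_int i \<and> real_of_int i \<le> y})"
  unfolding ints_between_eq by simp linarith

lemma ints_near_eq: "{i::int. \<bar>real_of_int i - x\<bar> \<le> r} = {\<lceil>x - r\<rceil>..\<lfloor>x + r\<rfloor>}"
  unfolding ints_between_eq[symmetric] by auto

lemma finite_window: "finite (window H a b n)"
proof (rule finite_subset)
  show "window H a b n \<subseteq> {i. a * real n \<le> real_of_int i \<and> real_of_int i \<le> b * real n}"
    by (auto simp: window_def)
qed (simp add: ints_between_eq)

lemma card_ints_near_le: "card {i::int. \<bar>real_of_int i - x\<bar> \<le> real D} \<le> 2 * D + 1"
  unfolding ints_near_eq by simp linarith

locale divergent_windows =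
  fixes H :: "int set" and \<alpha> a b :: real
  assumes H_cases: "H = UNIV \<or> H = {0..} \<or> H = {1..}"
    and a_less_b: "a < b"
    and mass_diverges: "filterlim (\<lambda>n. pow_sum \<alpha> (window H a b n)) at_top sequentially"
begin

definition mass :: "int set \<Rightarrow> nat \<Rightarrow> real" where
  "mass X n = (\<Sum>i\<in>X \<inter> window H a b n. abs_pow i \<alpha>)"

lemma pow_sum_eq_mass: "pow_sum \<alpha> (X \<inter> window H a b n) = mass X n"
  by (simp add: mass_def pow_sum_eq_sum finite_window)

lemma H_inter_window: "H \<inter> window H a b n = window H a b n"
  by (auto simp: window_def)

lemma pow_sum_window: "pow_sum \<alpha> (window H a b n) = mass H n"
  using pow_sum_eq_mass[of H n] by (simp add: H_inter_window)

lemma mass_nonneg: "0 \<le> mass X n"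
  by (simp add: mass_def sum_nonneg)

lemma mass_mono: "X \<subseteq> Y \<Longrightarrow> mass X n \<le> mass Y n"
  unfolding mass_def by (intro sum_mono2) (auto simp: finite_window)

lemma mass_le_H: "mass X n \<le> mass H n"
  unfolding mass_def H_inter_window by (intro sum_mono2) (auto simp: finite_window)

lemma mass_Un_le: "mass (X \<union> Y) n \<le> mass X n + mass Y n"
proof -
  have "mass (X \<union> Y) n + mass (X \<inter> Y) n = mass X n + mass Y n"
    unfolding mass_def Int_Un_distrib2
    using sum.union_inter[of "X \<inter> window H a b n" "Y \<inter> window H a b n"]
    by (simp add: finite_window Int_ac)
  then show ?thesis using mass_nonneg[of "X \<inter> Y" n] by linarith
qed

lemma mass_H_at_top: "filterlim (mass H) at_top sequentially"
  using mass_diverges by (simp add: pow_sum_window)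

section \<open>The total weight of a window against a single weight\<close>

lemma window_subset_0_if_b_nonpos:
  assumes "b \<le> 0" "H \<noteq> UNIV"
  shows "window H a b n \<subseteq> {0}"
proof
  fix i assume i: "i \<in> window H a b n"
  have "b * real n \<le> 0" using assms by (simp add: mult_nonpos_nonneg)
  then have "real_of_int i \<le> 0" using i by (auto simp: window_def)
  then show "i \<in> {0}" using i assms H_cases by (auto simp: window_def)
qed

text \<open>Otherwise every window is contained in \<open>{0}\<close>, and its weight stays bounded.\<close>

lemma b_pos_or_H_UNIV: "0 < b \<or> H = UNIV"
proof (rule ccontr)
  assume "\<not> ?thesis"
  then have "window H a b n \<subseteq> {0}" for n using window_subset_0_if_b_nonpos by auto
  then have "mass H n \<le> (\<Sum>i\<in>{0}. abs_pow i \<alpha>)" for n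
    unfolding mass_def H_inter_window by (intro sum_mono2) auto
  moreover have "eventually (\<lambda>n. mass H n > (\<Sum>i\<in>{0}. abs_pow i \<alpha>)) sequentially"
    using mass_H_at_top by (simp add: filterlim_at_top_dense)
  ultimately show False by (auto simp: eventually_sequentially not_less[symmetric])
qed

lemma mass_H_ge_of_subinterval:
  assumes "0 \<le> \<alpha>" "0 < \<rho>"
    and sub: "\<And>i. c * real m \<le> real_of_int i \<Longrightarrow> real_of_int i \<le> d * real m \<Longrightarrow>
            i \<in> window H a b m \<and> \<rho> * real m \<le> \<bar>real_of_int i\<bar>"
    and m: "m > 0"
  shows "((d - c) * real m - 1) * (\<rho> * real m) powr \<alpha> \<le> mass H m"
proof -
  let ?I = "{i::int. c * real m \<le> real_of_int i \<and> real_of_int i \<le> d * real m}"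
  have w: "(\<rho> * real m) powr \<alpha> \<le> abs_pow i \<alpha>" if "i \<in> ?I" for i
  proof -
    have le: "\<rho> * real m \<le> \<bar>real_of_int i\<bar>" using sub that by auto
    moreover have "0 < \<rho> * real m" using assms m by simp
    ultimately show ?thesis using assms by (auto simp: abs_pow_def intro!: powr_mono2)
  qed
  have "((d - c) * real m - 1) * (\<rho> * real m) powr \<alpha> \<le> real (card ?I) * (\<rho> * real m) powr \<alpha>"
    using card_ints_between_ge[where y = "d * real m" and x = "c * real m"]
    by (intro mult_right_mono) (auto simp: algebra_simps)
  also have "\<dots> \<le> (\<Sum>i\<in>?I. abs_pow i \<alpha>)"
    using w by (intro sum_bounded_below) auto
  also have "\<dots> \<le> mass H m"
    unfolding mass_def H_inter_window using sub by (intro sum_mono2) (auto simp: finite_window)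
  finally show ?thesis .
qed

text \<open>Since \<open>a < b\<close>, some interval \<open>[c m, d m]\<close> with \<open>c < d\<close> lies in \<open>[a m, b m]\<close> at distance at least
  \<open>\<rho> m\<close> from \<open>0\<close>, on the positive side if \<open>b > 0\<close> and on the negative side otherwise. It has about
  \<open>(d - c) m\<close> integers, so \<open>S m\<close> has order at least \<open>m\<^sup>\<alpha>\<^sup>+\<^sup>1\<close>.\<close>

lemma mass_H_lower_bound:
  assumes "0 \<le> \<alpha>"
  obtains \<rho> \<sigma> where "\<rho> > 0" "\<sigma> > 0"
    "\<And>m. m > 0 \<Longrightarrow> (\<sigma> * real m - 1) * (\<rho> * real m) powr \<alpha> \<le> mass H m"
proof (cases "0 < b")
  case True
  define c where "c = max a (b/2)"
  have c: "c < b" "a \<le> c" "b/2 \<le> c" using True a_less_b by (auto simp: c_def)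
  show ?thesis
  proof (rule that[of "b/2" "b - c"])
    fix m :: nat assume m: "m > 0"
    show "((b - c) * real m - 1) * (b / 2 * real m) powr \<alpha> \<le> mass H m"
    proof (rule mass_H_ge_of_subinterval[OF assms _ _ m])
      fix i assume i: "c * real m \<le> real_of_int i" "real_of_int i \<le> b * real m"
      have "a * real m \<le> c * real m" "b/2 * real m \<le> c * real m"
        by (rule mult_right_mono[OF c(2)] mult_right_mono[OF c(3)], simp)+
      moreover have "0 < b/2 * real m" using True m by simp
      ultimately show "i \<in> window H a b m \<and> b / 2 * real m \<le> \<bar>real_of_int i\<bar>"
        using i H_cases by (auto simp: window_def)
    qed (use True in auto)
  qed (use True c in auto)
next
  case False
  then have H: "H = UNIV" using b_pos_or_H_UNIV by auto
  define c where "c = min b (a/2)"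
  have c: "a < c" "c \<le> b" "c \<le> a/2" "a < 0" using False a_less_b by (auto simp: c_def)
  show ?thesis
  proof (rule that[of "- a/2" "c - a"])
    fix m :: nat assume m: "m > 0"
    show "((c - a) * real m - 1) * (- a / 2 * real m) powr \<alpha> \<le> mass H m"
    proof (rule mass_H_ge_of_subinterval[OF assms _ _ m])
      fix i assume i: "a * real m \<le> real_of_int i" "real_of_int i \<le> c * real m"
      have "c * real m \<le> b * real m" "c * real m \<le> a/2 * real m"
        by (rule mult_right_mono[OF c(2)] mult_right_mono[OF c(3)], simp)+
      then show "i \<in> window H a b m \<and> - a / 2 * real m \<le> \<bar>real_of_int i\<bar>"
        using i H by (auto simp: window_def)
    qed (use c in auto)
  qed (use c in auto)
qed

lemma const_over_mass_H_tendsto_0: "(\<lambda>m. C / mass H m) \<longlonglongrightarrow> 0"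
  by (rule real_tendsto_divide_at_top[OF tendsto_const mass_H_at_top])

text \<open>The numerator bounds every weight in a neighbourhood of a window (see \<open>abs_pow_le\<close>). For
  \<open>\<alpha> \<le> 0\<close> it is at most \<open>2\<close>; for \<open>\<alpha> > 0\<close> it has order \<open>m\<^sup>\<alpha>\<close>, one power of \<open>m\<close> below \<open>S m\<close>.\<close>

lemma boundary_weight_negligible:
  assumes "0 \<le> L" "1 \<le> D"
  shows "(\<lambda>m. (1 + (L * real m + D) powr \<alpha>) / mass H m) \<longlonglongrightarrow> 0"
proof (cases "\<alpha> \<le> 0")
  case True
  show ?thesis
  proof (rule tendsto_sandwich[OF _ _ tendsto_const const_over_mass_H_tendsto_0[of 2]])
    show "\<forall>\<^sub>F m in sequentially. (1 + (L * real m + D) powr \<alpha>) / mass H m \<le> 2 / mass H m"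
    proof (intro always_eventually allI divide_right_mono mass_nonneg)
      fix m :: nat
      have "1 \<le> L * real m + D" using assms by (simp add: add_increasing)
      then have "(L * real m + D) powr \<alpha> \<le> (L * real m + D) powr 0"
        using True by (intro powr_mono) auto
      then show "1 + (L * real m + D) powr \<alpha> \<le> 2"
        using \<open>1 \<le> L * real m + D\<close> by simp
    qed
  qed (simp add: mass_nonneg)
next
  case False
  obtain \<rho> \<sigma> where rs: "\<rho> > 0" "\<sigma> > 0"
    "\<And>m. m > 0 \<Longrightarrow> (\<sigma> * real m - 1) * (\<rho> * real m) powr \<alpha> \<le> mass H m"
    using mass_H_lower_bound False by (metis linear)
  define K where "K = ((L + D) / \<rho>) powr \<alpha>"
  have "filterlim (\<lambda>m. - 1 + \<sigma> * real m) at_top sequentially"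
    by (rule filterlim_tendsto_add_at_top[OF tendsto_const])
      (rule filterlim_tendsto_pos_mult_at_top[OF tendsto_const rs(2) filterlim_real_sequentially])
  then have sig: "filterlim (\<lambda>m. \<sigma> * real m - 1) at_top sequentially" by simp
  have "(\<lambda>m. 1 / mass H m + K / (\<sigma> * real m - 1)) \<longlonglongrightarrow> 0 + 0"
    by (intro tendsto_add const_over_mass_H_tendsto_0 real_tendsto_divide_at_top[OF tendsto_const sig])
  then have lim: "(\<lambda>m. 1 / mass H m + K / (\<sigma> * real m - 1)) \<longlonglongrightarrow> 0" by simp
  have "eventually (\<lambda>m. \<sigma> * real m - 1 > 0) sequentially"
    using sig unfolding filterlim_at_top_dense by blast
  then have bnd: "\<forall>\<^sub>F m in sequentially. (1 + (L * real m + D) powr \<alpha>) / mass H m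
      \<le> 1 / mass H m + K / (\<sigma> * real m - 1)"
    using eventually_gt_at_top[of 0]
  proof eventually_elim
    case (elim m)
    let ?q = "(\<rho> * real m) powr \<alpha>"
    have q: "0 < ?q" using elim rs by simp
    have "L * real m + D \<le> L * real m + D * real m" using assms elim by simp
    also have "\<dots> = (L + D) / \<rho> * (\<rho> * real m)" using rs by (simp add: field_simps)
    finally have "(L * real m + D) powr \<alpha> \<le> ((L + D) / \<rho> * (\<rho> * real m)) powr \<alpha>"
      using assms False by (intro powr_mono2) auto
    also have "\<dots> = K * ?q"
      using assms rs by (simp only: K_def powr_mult[symmetric])
    finally have "(L * real m + D) powr \<alpha> / mass H m \<le> K * ?q / mass H m"
      by (intro divide_right_mono mass_nonneg)
    also have "\<dots> \<le> K * ?q / ((\<sigma> * real m - 1) * ?q)"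
    proof (rule divide_left_mono)
      have "0 < (\<sigma> * real m - 1) * ?q" using elim q by simp
      then show "0 < mass H m * ((\<sigma> * real m - 1) * ?q)"
        using rs(3)[OF elim(2)] by (metis less_le_trans mult_pos_pos)
      show "0 \<le> K * ?q" by (simp add: K_def)
    qed (use rs(3)[OF elim(2)] in simp)
    also have "\<dots> = K / (\<sigma> * real m - 1)" using q by simp
    finally show ?case by (simp add: add_divide_distrib)
  qed
  show ?thesis
    by (rule tendsto_sandwich[OF _ bnd tendsto_const lim]) (simp add: mass_nonneg)
qed

section \<open>Weights of affine images\<close>

lemma affine_image_in_H: "X \<subseteq> H \<Longrightarrow> k \<ge> 1 \<Longrightarrow> (\<lambda>x. int k * x + int h) ` X \<subseteq> H"
proof -
  assume X: "X \<subseteq> H" and k: "k \<ge> 1"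
  have "int k * x + int h \<in> H" if "x \<in> X" for x
  proof -
    have "x \<in> H" using X that by auto
    moreover have "x \<le> int k * x + int h" if "0 \<le> x"
      using mult_right_mono[of 1 "int k" x] k that by simp
    ultimately show ?thesis using H_cases by force
  qed
  then show ?thesis by auto
qed

text \<open>Pulled back along \<open>x \<mapsto> k x + h\<close>, the left term is a sum over the set \<open>A n\<close> of those \<open>j \<in> X\<close> with
  \<open>k j + h \<in> F\<^sub>n\<close>, to be compared with the sum over \<open>B m = X \<inter> F\<^sub>m\<close>, \<open>m = n div k\<close>. Writing
  \<open>n = k m + s\<close>, the condition \<open>c n \<le> k j + h\<close> reads \<open>c m + (c s - h)/k \<le> j\<close>, and as \<open>s < k\<close>
  the shift is bounded. So \<open>A n\<close> and \<open>B m\<close> differ only inside the set \<open>Z m\<close> of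
  integers within distance \<open>D\<close> of an end point of the window, which has bounded size.\<close>

lemma mass_affine_image:
  assumes k: "k \<ge> 1" and X: "X \<subseteq> H"
  shows "(\<lambda>n. (mass ((\<lambda>x. int k * x + int h) ` X) n - real k powr \<alpha> * mass X (n div k))
            / mass H (n div k)) \<longlonglongrightarrow> 0"
proof -
  let ?f = "\<lambda>x. int k * x + int h"
  let ?w = "\<lambda>i. abs_pow i \<alpha>"
  let ?c = "real k powr \<alpha>"
  \<comment> \<open>\<open>D\<close> bounds the shift of the end points; the summand \<open>1\<close> makes \<open>L m + D \<ge> 1\<close> even for \<open>m = 0\<close>.\<close>
  obtain D :: nat where D: "\<bar>a\<bar> + \<bar>b\<bar> + real h + 1 \<le> real D" using real_arch_simple by blast
  define L where "L = \<bar>a\<bar> + \<bar>b\<bar>"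
  define U where "U m = 1 + (L * real m + real D) powr \<alpha>" for m
  define A where "A n = {j \<in> X. ?f j \<in> window H a b n}" for n
  define B where "B m = X \<inter> window H a b m" for m
  define Z where "Z m = {i::int. \<bar>real_of_int i - a * real m\<bar> \<le> real D}
                \<union> {i. \<bar>real_of_int i - b * real m\<bar> \<le> real D}" for m :: nat
  have inj: "inj_on ?f S" for S using k by (auto simp: inj_on_def)
  have finB: "finite (B m)" for m by (simp add: B_def finite_window)
  have finA: "finite (A n)" for n
    using finite_vimageI[OF finite_window[of H a b n] inj] unfolding A_def
    by (rule rev_finite_subset) auto
  have finZ: "finite (Z m)" for m by (simp add: Z_def ints_near_eq)
  have cardZ: "card (Z m) \<le> 4 * D + 2" for m
    unfolding Z_def using card_ints_near_le[of "a * real m" D] card_ints_near_le[of "b * real m" D]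
      card_Un_le[of "{i::int. \<bar>real_of_int i - a * real m\<bar> \<le> real D}"
        "{i::int. \<bar>real_of_int i - b * real m\<bar> \<le> real D}"] by linarith
  have massf: "mass (?f ` X) n = (\<Sum>j\<in>A n. ?w (?f j))" for n
  proof -
    have "?f ` X \<inter> window H a b n = ?f ` A n" by (auto simp: A_def)
    then show ?thesis by (simp add: mass_def sum.reindex[OF inj])
  qed
  have massX: "mass X m = (\<Sum>j\<in>B m. ?w j)" for m by (simp add: mass_def B_def)
  have wZ: "?w i \<le> U m" if "i \<in> Z m" for i m
    unfolding U_def
  proof (rule abs_pow_le)
    have "\<bar>a * real m\<bar> + \<bar>b * real m\<bar> = L * real m" by (simp add: L_def abs_mult algebra_simps)
    then show "\<bar>real_of_int i\<bar> \<le> L * real m + real D" using that unfolding Z_def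
      by (auto simp: abs_le_iff)
    show "1 \<le> L * real m + real D" using D by (simp add: L_def add_increasing)
  qed
  have sumZ: "(\<Sum>i\<in>Z m. ?w i) \<le> real (4 * D + 2) * U m" for m
  proof -
    have "(\<Sum>i\<in>Z m. ?w i) \<le> real (card (Z m)) * U m"
      using wZ by (intro sum_bounded_above) auto
    also have "\<dots> \<le> real (4 * D + 2) * U m"
      using cardZ[of m] by (intro mult_right_mono) (auto simp: U_def add_nonneg_nonneg simp del: of_nat_add)
    finally show ?thesis .
  qed
  have symdiff: "A n - B (n div k) \<subseteq> Z (n div k)" "B (n div k) - A n \<subseteq> Z (n div k)" for n
  proof -
    define m s where "m = n div k" and "s = n mod k"
    have n: "real n = real k * real m + real s"
      by (metis m_def s_def mult_div_mod_eq of_nat_add of_nat_mult)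
    have s: "real s \<le> real k" using k by (simp add: s_def less_imp_le)
    have near: "\<bar>c * real s\<bar> + real h \<le> real k * real D" if "c = a \<or> c = b" for c
    proof -
      have "\<bar>c * real s\<bar> \<le> (\<bar>a\<bar> + \<bar>b\<bar>) * real k"
        unfolding abs_mult using that s by (intro mult_mono) auto
      moreover have "real h \<le> real h * real k" using k by (simp add: mult_le_cancel_left1)
      ultimately have "\<bar>c * real s\<bar> + real h \<le> real k * (\<bar>a\<bar> + \<bar>b\<bar> + real h)"
        by (simp add: algebra_simps)
      also have "\<dots> \<le> real k * real D" using D by (intro mult_left_mono) auto
      finally show ?thesis .
    qed
    have cn: "c * real n = real k * (c * real m) + c * real s" for c
      by (simp add: n algebra_simps)
    \<comment> \<open>If \<open>j\<close> and \<open>k j + h\<close> lie on different sides of \<open>c m\<close> and \<open>c n\<close>, then \<open>j\<close> is near \<open>c m\<close>.\<close>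
    have close: "\<bar>real_of_int j - c * real m\<bar> \<le> real D"
      if "c = a \<or> c = b"
        and "(c * real n \<le> real_of_int (?f j) \<and> \<not> c * real m \<le> real_of_int j) \<or>
             (\<not> c * real n \<le> real_of_int (?f j) \<and> c * real m \<le> real_of_int j) \<or>
             (c * real n \<ge> real_of_int (?f j) \<and> \<not> c * real m \<ge> real_of_int j) \<or>
             (\<not> c * real n \<ge> real_of_int (?f j) \<and> c * real m \<ge> real_of_int j)" for c j
    proof -
      have f: "real_of_int (?f j) - c * real n =
           real k * (real_of_int j - c * real m) - (c * real s - real h)"
        by (simp add: cn algebra_simps)
      have le0: "real k * x \<le> 0" if "x \<le> 0" for x using that by (simp add: mult_nonneg_nonpos)
      have ge0: "0 \<le> real k * x" if "x \<ge> 0" for x using that by simp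
      have "\<bar>real k * (real_of_int j - c * real m)\<bar> \<le> \<bar>c * real s\<bar> + real h"
        using f that(2) le0[of "real_of_int j - c * real m"] ge0[of "real_of_int j - c * real m"]
        by linarith
      then have "real k * \<bar>real_of_int j - c * real m\<bar> \<le> real k * real D"
        using near[OF that(1)] by (simp add: abs_mult)
      then show ?thesis using k by simp
    qed
    have fH: "?f j \<in> H" "j \<in> H" if "j \<in> X" for j
      using affine_image_in_H[OF X k, of h] X that by auto
    show "A n - B (n div k) \<subseteq> Z (n div k)"
      unfolding m_def[symmetric] A_def B_def Z_def
      using close fH by (auto simp: window_def)
    show "B (n div k) - A n \<subseteq> Z (n div k)"
      unfolding m_def[symmetric] A_def B_def Z_def
      using close fH by (auto simp: window_def simp del: of_int_add of_int_mult)
  qed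
  have le_Z: "(\<Sum>i\<in>S. ?w i) \<le> (\<Sum>i\<in>T. ?w i) + real (4 * D + 2) * U m"
    if "S - T \<subseteq> Z m" "finite S" "finite T" for S T m
  proof -
    have "(\<Sum>i\<in>S. ?w i) \<le> (\<Sum>i\<in>T \<union> Z m. ?w i)"
      using that finZ by (intro sum_mono2) auto
    also have "\<dots> \<le> (\<Sum>i\<in>T. ?w i) + (\<Sum>i\<in>Z m. ?w i)"
      using that finZ sum.union_inter[of T "Z m" ?w] sum_nonneg[of "T \<inter> Z m" ?w] by simp
    finally show ?thesis using sumZ[of m] by linarith
  qed
  have divk: "filterlim (\<lambda>n. n div k) sequentially sequentially"
    using k by (intro filterlim_at_top_div_const_nat) auto
  show ?thesis
  proof (rule tendstoI)
    fix \<epsilon> :: real assume \<epsilon>: "\<epsilon> > 0"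
    obtain R :: nat where R: "\<And>j. int R \<le> \<bar>j\<bar> \<Longrightarrow> \<bar>?w (?f j) - ?c * ?w j\<bar> \<le> \<epsilon>/2 * ?w j"
      using abs_pow_affine_asymp[OF k, of "\<epsilon>/2"] \<epsilon> by (metis half_gt_zero)
    \<comment> \<open>\<open>E\<close> absorbs the finitely many small \<open>j\<close>, for which the relative error may exceed \<open>\<epsilon>/2\<close>.\<close>
    define E where "E = (\<Sum>j\<in>{-int R..int R}. \<bar>?w (?f j) - ?c * ?w j\<bar>)"
    define M where "M m = \<epsilon>/2 * mass H m + (E + (\<epsilon>/2 + ?c) * (real (4 * D + 2) * U m))" for m
    have err: "\<bar>mass (?f ` X) n - ?c * mass X (n div k)\<bar> \<le> M (n div k)" for n
    proof -
      define m where "m = n div k"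
      note sd = symdiff[of n, folded m_def]
      have AB: "(\<Sum>j\<in>A n. ?w j) \<le> (\<Sum>j\<in>B m. ?w j) + real (4 * D + 2) * U m"
        "(\<Sum>j\<in>B m. ?w j) \<le> (\<Sum>j\<in>A n. ?w j) + real (4 * D + 2) * U m"
        using le_Z sd finA finB by auto
      \<comment> \<open>Replace the weights of the image points over \<open>A n\<close> first, then \<open>A n\<close> by \<open>B m\<close>.\<close>
      have "\<bar>(\<Sum>j\<in>A n. ?w (?f j)) - ?c * (\<Sum>j\<in>A n. ?w j)\<bar>
          \<le> (\<Sum>j\<in>A n. \<bar>?w (?f j) - ?c * ?w j\<bar>)"
        unfolding sum_distrib_left sum_subtractf[symmetric] by (rule sum_abs)
      also have "\<dots> \<le> (\<Sum>j\<in>A n. \<epsilon>/2 * ?w j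
           + (if j \<in> {-int R..int R} then \<bar>?w (?f j) - ?c * ?w j\<bar> else 0))"
      proof (intro sum_mono)
        fix j
        show "\<bar>?w (?f j) - ?c * ?w j\<bar> \<le> \<epsilon>/2 * ?w j
           + (if j \<in> {-int R..int R} then \<bar>?w (?f j) - ?c * ?w j\<bar> else 0)"
          using R[of j] \<epsilon> by (auto simp: abs_if split: if_splits)
      qed
      also have "\<dots> = \<epsilon>/2 * (\<Sum>j\<in>A n. ?w j)
           + (\<Sum>j\<in>A n \<inter> {-int R..int R}. \<bar>?w (?f j) - ?c * ?w j\<bar>)"
        by (simp only: sum.distrib sum_distrib_left sum.inter_restrict[OF finA])
      also have "\<dots> \<le> \<epsilon>/2 * (\<Sum>j\<in>A n. ?w j) + E"
        unfolding E_def by (intro add_left_mono sum_mono2) auto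
      also have "\<dots> \<le> \<epsilon>/2 * (mass H m + real (4 * D + 2) * U m) + E"
        using AB(1) mass_le_H[of X m] \<epsilon> unfolding massX
        by (intro add_right_mono mult_left_mono) auto
      finally have 1: "\<bar>(\<Sum>j\<in>A n. ?w (?f j)) - ?c * (\<Sum>j\<in>A n. ?w j)\<bar>
          \<le> \<epsilon>/2 * (mass H m + real (4 * D + 2) * U m) + E" .
      have "\<bar>?c * (\<Sum>j\<in>A n. ?w j) - ?c * (\<Sum>j\<in>B m. ?w j)\<bar>
          = ?c * \<bar>(\<Sum>j\<in>A n. ?w j) - (\<Sum>j\<in>B m. ?w j)\<bar>"
        by (simp add: abs_mult right_diff_distrib[symmetric])
      also have "\<dots> \<le> ?c * (real (4 * D + 2) * U m)"
        using AB by (intro mult_left_mono) (auto simp: abs_le_iff)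
      finally have 2: "\<bar>?c * (\<Sum>j\<in>A n. ?w j) - ?c * (\<Sum>j\<in>B m. ?w j)\<bar>
          \<le> ?c * (real (4 * D + 2) * U m)" .
      have "M m = \<epsilon>/2 * (mass H m + real (4 * D + 2) * U m) + E + ?c * (real (4 * D + 2) * U m)"
        by (simp only: M_def distrib_left distrib_right add_ac)
      then show ?thesis
        using 1 2 unfolding massf massX m_def[symmetric] by linarith
    qed
    have "(\<lambda>m. E / mass H m + (\<epsilon>/2 + ?c) * real (4 * D + 2) * (U m / mass H m))
        \<longlonglongrightarrow> 0 + (\<epsilon>/2 + ?c) * real (4 * D + 2) * 0"
      unfolding U_def using D
      by (intro tendsto_add tendsto_mult tendsto_const const_over_mass_H_tendsto_0
          boundary_weight_negligible) (auto simp: L_def)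
    then have "\<forall>\<^sub>F m in sequentially. E / mass H m +
        (\<epsilon>/2 + ?c) * real (4 * D + 2) * (U m / mass H m) < \<epsilon>/2"
      using \<epsilon> by (intro order_tendstoD(2)[where y = 0]) auto
    moreover have "\<forall>\<^sub>F m in sequentially. mass H m > 0"
      using mass_H_at_top by (simp add: filterlim_at_top_dense)
    ultimately have "\<forall>\<^sub>F m in sequentially. M m < \<epsilon> * mass H m \<and> mass H m > 0"
    proof eventually_elim
      case (elim m)
      have "M m / mass H m = \<epsilon>/2 + (E / mass H m +
          (\<epsilon>/2 + ?c) * real (4 * D + 2) * (U m / mass H m))"
        using elim(2) unfolding M_def
        by (simp only: add_divide_distrib times_divide_eq_right mult.assoc) simp
      also have "\<dots> < \<epsilon>/2 + \<epsilon>/2" using elim(1) by (rule add_strict_left_mono)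
      finally have "M m / mass H m < \<epsilon>" by simp
      then show ?case using elim(2) by (simp add: divide_less_eq)
    qed
    then have "\<forall>\<^sub>F n in sequentially. M (n div k) < \<epsilon> * mass H (n div k) \<and> mass H (n div k) > 0"
      using divk by (rule eventually_compose_filterlim)
    then show "\<forall>\<^sub>F n in sequentially. dist ((mass (?f ` X) n - ?c * mass X (n div k))
            / mass H (n div k)) 0 < \<epsilon>"
    proof eventually_elim
      case (elim n)
      then show ?case using err[of n]
        by (simp add: divide_less_eq)
    qed
  qed
qed

text \<open>Every element of \<open>H\<close> other than finitely many lies in exactly one progression \<open>k \<cdot> H + r\<close> with
  \<open>r < k\<close>, and each progression carries weight \<open>k\<^sup>\<alpha> S (n div k)\<close> asymptotically.\<close>

lemma mass_H_growth:
  assumes k: "k \<ge> 1"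
  shows "(\<lambda>n. mass H n / mass H (n div k)) \<longlonglongrightarrow> real k * real k powr \<alpha>"
proof -
  let ?f = "\<lambda>r x. int k * x + int r"
  let ?c = "real k powr \<alpha>"
  \<comment> \<open>The remainder is empty unless \<open>H = {1..}\<close>, when it is \<open>{1..<k}\<close>.\<close>
  define V where "V = H - (\<Union>r<k. ?f r ` H)"
  have V: "V \<subseteq> {0..<int k}"
  proof
    fix i assume i: "i \<in> V"
    define r where "r = nat (i mod int k)"
    have r: "r < k" "i = ?f r (i div int k)" using k by (auto simp: r_def nat_less_iff)
    then have nH: "i div int k \<notin> H" and iH: "i \<in> H" using i unfolding V_def by blast+
    have "0 \<le> i" using iH nH H_cases by auto
    moreover have "i < int k"
    proof (rule ccontr)
      assume "\<not> i < int k"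
      then have "1 \<le> i div int k" using k by (simp add: pos_imp_zdiv_pos_iff int_one_le_iff_zero_less)
      then show False using nH H_cases by auto
    qed
    ultimately show "i \<in> {0..<int k}" by simp
  qed
  have disj: "?f r ` H \<inter> ?f r' ` H = {}" if "r < k" "r' < k" "r \<noteq> r'" for r r'
  proof (rule ccontr)
    assume "?f r ` H \<inter> ?f r' ` H \<noteq> {}"
    then obtain x y where "?f r x = ?f r' y" by auto
    then have "?f r x mod int k = ?f r' y mod int k" by simp
    then show False using that by simp
  qed
  have split: "mass H n = (\<Sum>r<k. mass (?f r ` H) n) + mass V n" for n
  proof -
    let ?W = "window H a b n"
    have disjW: "(?f r ` H \<inter> ?W) \<inter> (?f r' ` H \<inter> ?W) = {}"
      if "r \<in> {..<k}" "r' \<in> {..<k}" "r \<noteq> r'" for r r'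
      using disj[of r r'] that by blast
    have "?f r ` H \<subseteq> H" for r using affine_image_in_H k by blast
    then have "H \<inter> ?W = (\<Union>r<k. ?f r ` H \<inter> ?W) \<union> (V \<inter> ?W)" by (auto simp: V_def)
    then have "mass H n = (\<Sum>i\<in>(\<Union>r<k. ?f r ` H \<inter> ?W) \<union> (V \<inter> ?W). abs_pow i \<alpha>)"
      by (simp add: mass_def)
    also have "\<dots> = (\<Sum>i\<in>(\<Union>r<k. ?f r ` H \<inter> ?W). abs_pow i \<alpha>) + mass V n"
      unfolding mass_def by (intro sum.union_disjoint) (auto simp: finite_window V_def)
    also have "(\<Sum>i\<in>(\<Union>r<k. ?f r ` H \<inter> ?W). abs_pow i \<alpha>) = (\<Sum>r<k. mass (?f r ` H) n)"
      unfolding mass_def by (intro sum.UNION_disjoint ballI impI finite_Int disjI2 finite_window disjW) auto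
    finally show ?thesis .
  qed
  have divk: "filterlim (\<lambda>n. n div k) sequentially sequentially"
    using k by (intro filterlim_at_top_div_const_nat) auto
  define C where "C = (\<Sum>i\<in>{0..<int k}. abs_pow i \<alpha>)"
  have VC: "mass V n \<le> C" for n
    unfolding mass_def C_def using V by (intro sum_mono2) auto
  have limV: "(\<lambda>n. mass V n / mass H (n div k)) \<longlonglongrightarrow> 0"
  proof (rule tendsto_sandwich[OF _ _ tendsto_const])
    show "(\<lambda>n. C / mass H (n div k)) \<longlonglongrightarrow> 0"
      using filterlim_compose[OF const_over_mass_H_tendsto_0 divk] .
  qed (auto simp: mass_nonneg VC intro!: always_eventually divide_right_mono)
  have "(\<lambda>n. (\<Sum>r<k. (mass (?f r ` H) n - ?c * mass H (n div k)) / mass H (n div k))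
        + mass V n / mass H (n div k) + real k * ?c) \<longlonglongrightarrow> (\<Sum>r<k. 0) + 0 + real k * ?c"
    by (intro tendsto_add tendsto_sum mass_affine_image k order_refl limV tendsto_const)
  moreover have "\<forall>\<^sub>F n in sequentially. mass H (n div k) > 0"
    using filterlim_compose[OF mass_H_at_top divk] by (simp add: filterlim_at_top_dense)
  then have "\<forall>\<^sub>F n in sequentially. (\<Sum>r<k. (mass (?f r ` H) n - ?c * mass H (n div k)) / mass H (n div k))
        + mass V n / mass H (n div k) + real k * ?c = mass H n / mass H (n div k)"
  proof eventually_elim
    case (elim n)
    have "(\<Sum>r<k. (mass (?f r ` H) n - ?c * mass H (n div k)) / mass H (n div k))
       = (\<Sum>r<k. mass (?f r ` H) n) / mass H (n div k) - real k * ?c"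
      using elim by (simp add: diff_divide_distrib sum_subtractf sum_divide_distrib)
    then show ?case by (simp add: split[of n] add_divide_distrib)
  qed
  ultimately show ?thesis by (simp add: tendsto_cong)
qed

section \<open>The upper density\<close>

definition rel_mass :: "int set \<Rightarrow> nat \<Rightarrow> real" where
  "rel_mass X n = ratio (mass X n) (mass H n)"

abbreviation upper :: "int set \<Rightarrow> ereal" where
  "upper X \<equiv> limsup (\<lambda>n. ereal (rel_mass X n))"

lemma weighted_limsup_eq_upper: "weighted_limsup H a b \<alpha> X = upper X"
  by (simp add: weighted_limsup_def rel_mass_def pow_sum_eq_mass pow_sum_window)

text \<open>A window of weight \<open>0\<close> gives relative weight \<open>1\<close> to every set, so the pointwise inequalities
  below hold for all \<open>n\<close>, not just for large ones.\<close>

lemma rel_mass_eq: "rel_mass X n = (if mass H n = 0 then 1 else mass X n / mass H n)"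
  using mass_le_H[of X n] mass_nonneg[of X n] by (simp add: rel_mass_def ratio_def)

lemma rel_mass_nonneg: "0 \<le> rel_mass X n"
  by (simp add: rel_mass_eq mass_nonneg)

lemma rel_mass_H: "rel_mass H n = 1"
  by (simp add: rel_mass_eq)

lemma rel_mass_mono: "mass X n \<le> mass Y n \<Longrightarrow> rel_mass X n \<le> rel_mass Y n"
  by (simp add: rel_mass_eq divide_right_mono mass_nonneg)

lemma rel_mass_le_1: "rel_mass X n \<le> 1"
  using rel_mass_mono[OF mass_le_H[of X n]] by (simp add: rel_mass_H)

lemma rel_mass_Un_le: "rel_mass (X \<union> Y) n \<le> rel_mass X n + rel_mass Y n"
  using divide_right_mono[OF mass_Un_le[of X Y n] mass_nonneg[of H n]]
  by (simp add: rel_mass_eq add_divide_distrib)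

text \<open>With \<open>m = n div k\<close>, \<open>g = S n / S m\<close> and \<open>err = (M Y n - k\<^sup>\<alpha> M X m) / S m\<close>, where \<open>Y\<close> is the
  image of \<open>X\<close>, the difference equals \<open>err / g + (k\<^sup>\<alpha> / g - 1/k) M X m / S m\<close>. Here \<open>err\<close> tends to
  \<open>0\<close>, \<open>g\<close> to \<open>k\<^sup>\<alpha>\<^sup>+\<^sup>1\<close>, and the last factor is bounded.\<close>

lemma rel_mass_affine_image:
  assumes k: "k \<ge> 1" and X: "X \<subseteq> H"
  shows "(\<lambda>n. rel_mass ((\<lambda>x. int k * x + int h) ` X) n - 1 / real k * rel_mass X (n div k))
            \<longlonglongrightarrow> 0"
proof -
  let ?Y = "(\<lambda>x. int k * x + int h) ` X"
  let ?c = "real k powr \<alpha>"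
  let ?err = "\<lambda>n. (mass ?Y n - ?c * mass X (n div k)) / mass H (n div k)"
  let ?g = "\<lambda>n. mass H n / mass H (n div k)"
  have c: "real k * ?c \<noteq> 0" using k by simp
  have divk: "filterlim (\<lambda>n. n div k) sequentially sequentially"
    using k by (intro filterlim_at_top_div_const_nat) auto
  have err: "(\<lambda>n. ?err n / ?g n) \<longlonglongrightarrow> 0"
    using tendsto_divide[OF mass_affine_image[OF k X] mass_H_growth[OF k] c] by simp
  have "(\<lambda>n. ?c / ?g n - 1 / real k) \<longlonglongrightarrow> ?c / (real k * ?c) - 1 / real k"
    by (intro tendsto_intros mass_H_growth k c)
  then have "(\<lambda>n. ?c / ?g n - 1 / real k) \<longlonglongrightarrow> 0" using k by simp
  moreover have "\<forall>\<^sub>F n in sequentially. norm (rel_mass X (n div k)) \<le> 1"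
    by (simp add: rel_mass_nonneg rel_mass_le_1)
  ultimately have drift: "(\<lambda>n. (?c / ?g n - 1 / real k) * rel_mass X (n div k)) \<longlonglongrightarrow> 0"
    by (intro lim_null_mult_right_bounded) auto
  have pos: "\<forall>\<^sub>F n in sequentially. mass H n > 0"
    using mass_H_at_top by (simp add: filterlim_at_top_dense)
  moreover have "\<forall>\<^sub>F n in sequentially. mass H (n div k) > 0"
    using eventually_compose_filterlim[OF pos divk] .
  ultimately have "\<forall>\<^sub>F n in sequentially. ?err n / ?g n + (?c / ?g n - 1 / real k) * rel_mass X (n div k)
      = rel_mass ?Y n - 1 / real k * rel_mass X (n div k)"
  proof eventually_elim
    case (elim n)
    then show ?case using k by (simp add: rel_mass_def ratio_def field_simps)
  qed
  then show ?thesis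
    using tendsto_add[OF err drift] by (simp add: tendsto_cong)
qed

lemma upper_affine_image:
  assumes k: "k \<ge> 1" and X: "X \<subseteq> H"
  shows "upper ((\<lambda>x. int k * x + int h) ` X) = ereal (1 / real k) * upper X"
proof -
  have "upper ((\<lambda>x. int k * x + int h) ` X)
      = limsup (\<lambda>n. ereal (1 / real k * rel_mass X (n div k)))"
    by (rule limsup_eq_of_diff_tendsto_0[OF rel_mass_affine_image[OF assms]])
  also have "\<dots> = limsup (\<lambda>n. ereal (1 / real k * rel_mass X n))"
    using limsup_div_const[OF k, of "\<lambda>n. ereal (1 / real k * rel_mass X n)"] .
  also have "\<dots> = limsup (\<lambda>n. ereal (1 / real k) * ereal (rel_mass X n))" by simp
  also have "\<dots> = ereal (1 / real k) * upper X"
    using k by (intro limsup_ereal_mult_left) auto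
  finally show ?thesis .
qed

lemma upper_bounds: "0 \<le> upper X" "upper X \<le> 1"
proof -
  show "upper X \<le> 1"
    by (rule Limsup_bounded) (auto simp: rel_mass_le_1 one_ereal_def)
  show "0 \<le> upper X"
    by (rule le_Limsup) (auto simp: rel_mass_nonneg zero_ereal_def)
qed

lemma upper_finite: "\<bar>upper X\<bar> \<noteq> \<infinity>"
  using upper_bounds[of X] by (cases "upper X") auto

lemma is_upper_density_upper: "is_upper_density H (\<lambda>X. real_of_ereal (upper X))"
  unfolding is_upper_density_def
proof (intro conjI allI impI)
  show "real_of_ereal (upper H) = 1"
    by (simp add: rel_mass_H Limsup_const)
next
  fix X Y :: "int set" assume "X \<subseteq> Y"
  then have "upper X \<le> upper Y" by (intro Limsup_mono always_eventually allI) (simp add: rel_mass_mono mass_mono)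
  then show "real_of_ereal (upper X) \<le> real_of_ereal (upper Y)"
    using upper_finite by (intro real_of_ereal_positive_mono) (auto simp: upper_bounds)
next
  fix X Y :: "int set"
  have "upper (X \<union> Y) \<le> limsup (\<lambda>n. ereal (rel_mass X n) + ereal (rel_mass Y n))"
    by (intro Limsup_mono) (auto simp: rel_mass_Un_le)
  also have "\<dots> \<le> upper X + upper Y" by (rule ereal_limsup_add_mono)
  finally show "real_of_ereal (upper (X \<union> Y)) \<le> real_of_ereal (upper X) + real_of_ereal (upper Y)"
    using upper_finite[of X] upper_finite[of Y] upper_finite[of "X \<union> Y"]
    by (cases "upper X"; cases "upper Y"; cases "upper (X \<union> Y)") auto
next
  fix X :: "int set" and k :: nat
  assume "X \<subseteq> H" "1 \<le> k"
  then show "real_of_ereal (upper ((\<lambda>x. int k * x) ` X)) = 1 / real k * real_of_ereal (upper X)"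
    using upper_affine_image[of k X 0] by simp
next
  fix X :: "int set" and h :: nat
  assume "X \<subseteq> H"
  then show "real_of_ereal (upper ((\<lambda>x. x + int h) ` X)) = real_of_ereal (upper X)"
    using upper_affine_image[of 1 X h] by (simp add: one_ereal_def[symmetric])
qed

end

theorem proposition3:
  fixes H :: "int set" and \<alpha> a b :: real
  assumes "H = UNIV \<or> H = {0..} \<or> H = {1..}"
    and "-1 \<le> \<alpha>"
    and "a < b"
    and "filterlim (\<lambda>n. pow_sum \<alpha> (window H a b n)) at_top sequentially"
  shows "(\<forall>X\<subseteq>H. \<bar>weighted_limsup H a b \<alpha> X\<bar> \<noteq> \<infinity>) \<and>
         is_upper_density H (\<lambda>X. real_of_ereal (weighted_limsup H a b \<alpha> X))"
proof -
  interpret divergent_windows H \<alpha> a b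
    using assms by unfold_locales
  show ?thesis
    using upper_finite is_upper_density_upper by (simp add: weighted_limsup_eq_upper)
qed

end
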